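(* Let $m,n\in\mathbb{N}$ with $m>n$, and for integers $k\geq0$ define \[ \lambda_k=\begin{cases} (k+1)\left(\dfrac{k+m-n+1}{(k+m+1)^2}\right) & \text{if } 0\leq k<m-n,\\[2ex] (k+1)\left(\dfrac{k+m-n+1}{(k+m+1)^2}-\dfrac{k+n-m+1}{(k+n+1)^2}\right) & \text{if } k\geq m-n. \end{cases} \] Then \[ \max_{k\geq0}\lambda_k<\frac{1}{2}. \]
   Context: $\mathbb{N}$ denotes the positive integers. The numbers $\lambda_k$, $k=0,1,2,\ldots$, are the eigenvalues of the self-commutator $[T^*_{z^m\bar{z}^n},T_{z^m\bar{z}^n}]$ of the Toeplitz operator with symbol $z^m\bar{z}^n$ on the Bergman space of the unit disk, and their maximum is the norm of that commutator. *)

theory Defs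
  imports Complex_Main
begin

text \<open>
  The arithmetic is carried out in the reals, so that only the case condition
  \<open>k < m - n\<close> uses (truncated) subtraction of natural numbers; it is the integer
  condition as soon as \<open>n \<le> m\<close>.
\<close>

definition ev :: "nat \<Rightarrow> nat \<Rightarrow> nat \<Rightarrow> real" where
  "ev m n k =
     (if k < m - n
      then (real k + 1) * ((real k + real m - real n + 1) / (real k + real m + 1)\<^sup>2)
      else (real k + 1) * ((real k + real m - real n + 1) / (real k + real m + 1)\<^sup>2
                         - (real k + real n - real m + 1) / (real k + real n + 1)\<^sup>2))"

end

theory Submission
  imports Defs "HOL-Real_Asymp.Real_Asymp"
begin

text \<open>
  Put \<open>x = k + 1\<close> and \<open>d = m - n\<close>, both regarded as positive reals.

  If \<open>k < m - n\<close>, then \<open>x \<le> d\<close>, and the eigenvalue \<open>x (x + d) / (x + d + n)\<^sup>2\<close> is strictly less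
  than its value \<open>x / (x + d) \<le> 1 / 2\<close> at \<open>n = 0\<close>.

  If \<open>k \<ge> m - n\<close>, then \<open>d < x\<close>. With \<open>y = x + n\<close> and \<open>S = y (y + d)\<close>, the product of the two
  denominators is \<open>S\<^sup>2\<close>, and completing a square shows that the distance of the eigenvalue to
  \<open>1 / 2\<close> is
  \<open>((S - 2 x d)\<^sup>2 + 2 x d (x (y - d) + (x y - d\<^sup>2))) / (2 S\<^sup>2)\<close>,
  which is positive because \<open>d < x < y\<close>. This is \<open>late_gap\<close>.

  A strict bound on every eigenvalue bounds the maximum strictly once the maximum is attained.
  It is attained because the eigenvalues tend to \<open>0\<close> (the two fractions, each multiplied by
  \<open>x\<close>, both tend to \<open>1\<close>), whereas the eigenvalue at \<open>k = 0\<close> is positive.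
\<close>

lemma early_bound:
  fixes x d n :: real
  assumes "0 < x" "x \<le> d" "0 < n"
  shows "x * ((x + d) / (x + d + n)\<^sup>2) < 1 / 2"
proof -
  have "2 * (x * (x + d)) \<le> (x + d) * (x + d)"
    using mult_right_mono[of "2 * x" "x + d" "x + d"] assms by (simp add: mult.assoc)
  also have "\<dots> < (x + d + n)\<^sup>2"
    unfolding power2_eq_square using assms by (intro mult_strict_mono) auto
  finally show ?thesis
    using assms by (simp add: field_simps)
qed

text \<open>
  The numerator of \<open>1 / 2 - x (\<dots>)\<close> over the denominator \<open>2 S\<^sup>2\<close> is
  \<open>S\<^sup>2 - 2 x d (2 S + d\<^sup>2 - x (2 y + d))\<close>; its part \<open>S\<^sup>2 - 4 x d S\<close> suggests the square
  \<open>(S - 2 x d)\<^sup>2\<close>, and what remains is a multiple of \<open>x d\<close>.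
\<close>

lemma late_gap:
  fixes x y d :: real
  assumes "y \<noteq> 0" "y + d \<noteq> 0"
  shows "1 / 2 - x * ((x + d) / (y + d)\<^sup>2 - (x - d) / y\<^sup>2) =
    ((y * (y + d) - 2 * x * d)\<^sup>2 + 2 * x * d * (x * (y - d) + (x * y - d\<^sup>2)))
      / (2 * (y * (y + d))\<^sup>2)"
proof -
  have "1 / 2 - x * ((x + d) / (y + d)\<^sup>2 - (x - d) / y\<^sup>2) =
    ((y * (y + d))\<^sup>2 - 2 * x * ((x + d) * y\<^sup>2 - (x - d) * (y + d)\<^sup>2))
      / (2 * (y * (y + d))\<^sup>2)"
    using assms by (simp add: divide_simps)
  also have "(y * (y + d))\<^sup>2 - 2 * x * ((x + d) * y\<^sup>2 - (x - d) * (y + d)\<^sup>2) =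
    (y * (y + d) - 2 * x * d)\<^sup>2 + 2 * x * d * (x * (y - d) + (x * y - d\<^sup>2))"
    by algebra
  finally show ?thesis .
qed

lemma late_bound:
  fixes x y d :: real
  assumes "0 < d" "d \<le> x" "x < y"
  shows "x * ((x + d) / (y + d)\<^sup>2 - (x - d) / y\<^sup>2) < 1 / 2"
proof -
  have "d\<^sup>2 \<le> x * y"
    unfolding power2_eq_square using assms by (intro mult_mono) auto
  moreover have "0 < x * (y - d)"
    using assms by simp
  ultimately have "0 < 2 * x * d * (x * (y - d) + (x * y - d\<^sup>2))"
    using assms by (intro mult_pos_pos) linarith+
  then have "0 < ((y * (y + d) - 2 * x * d)\<^sup>2 + 2 * x * d * (x * (y - d) + (x * y - d\<^sup>2)))
      / (2 * (y * (y + d))\<^sup>2)"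
    using assms by (intro divide_pos_pos add_nonneg_pos) auto
  then show ?thesis
    using late_gap[of y d x] assms by simp
qed

lemma ev_less_half:
  assumes "n \<ge> 1" "m > n"
  shows "ev m n k < 1 / 2"
proof (cases "k < m - n")
  case True
  then have "real k + 1 \<le> real m - real n"
    using assms by linarith
  then show ?thesis
    using early_bound[of "real k + 1" "real m - real n" "real n"] assms True
    by (simp add: ev_def algebra_simps)
next
  case False
  then have "real m - real n \<le> real k + 1"
    using assms by linarith
  then show ?thesis
    using late_bound[of "real m - real n" "real k + 1" "real k + 1 + real n"] assms False
    by (simp add: ev_def algebra_simps)
qed

lemma ev_tendsto_0: "ev m n \<longlonglongrightarrow> 0"
proof (rule Lim_transform_eventually)
  have quotient: "(\<lambda>k. (real k + 1) * ((real k + a) / (real k + b)\<^sup>2)) \<longlonglongrightarrow> 1" for a b :: real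
    by real_asymp
  show "(\<lambda>k. (real k + 1) * ((real k + (real m - real n + 1)) / (real k + (real m + 1))\<^sup>2)
           - (real k + 1) * ((real k + (real n - real m + 1)) / (real k + (real n + 1))\<^sup>2))
        \<longlonglongrightarrow> 0"
    using tendsto_diff[OF quotient quotient] by simp
  show "\<forall>\<^sub>F k in sequentially.
      (real k + 1) * ((real k + (real m - real n + 1)) / (real k + (real m + 1))\<^sup>2)
       - (real k + 1) * ((real k + (real n - real m + 1)) / (real k + (real n + 1))\<^sup>2)
      = ev m n k"
    using eventually_ge_at_top[of "m - n"]
    by eventually_elim (simp add: ev_def right_diff_distrib algebra_simps)
qed

lemma attains_max_of_tendsto:
  fixes f :: "nat \<Rightarrow> real"
  assumes "f \<longlonglongrightarrow> L" and "L < f j"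
  shows "\<exists>i. \<forall>k. f k \<le> f i"
proof -
  obtain N where N: "f k < f j" if "k \<ge> N" for k
    using order_tendstoD(2)[OF assms] by (auto simp: eventually_sequentially)
  define A where "A = f ` {..max N j}"
  have A: "finite A" "f j \<in> A"
    by (auto simp: A_def)
  then have "Max A \<in> A"
    by (intro Max_in) auto
  then obtain i where i: "f i = Max A"
    unfolding A_def by (metis imageE)
  have "f k \<le> f i" for k
  proof (cases "k \<le> N")
    case True
    then have "f k \<in> A"
      by (auto simp: A_def)
    then show ?thesis
      using A i by simp
  next
    case False
    then have "f k < f j"
      by (intro N) simp
    also have "f j \<le> f i"
      using A i by simp
    finally show ?thesis
      by simp
  qed
  then show ?thesis
    by blast
qed

theorem mainTheorem5:
  fixes m n :: nat
  assumes "n \<ge> 1" and "m > n"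
  shows "\<exists>M. M \<in> range (ev m n) \<and> (\<forall>k. ev m n k \<le> M) \<and> M < 1 / 2"
proof -
  have "0 < ev m n 0"
    using assms by (simp add: ev_def add_pos_pos)
  then obtain i where "\<forall>k. ev m n k \<le> ev m n i"
    using attains_max_of_tendsto[OF ev_tendsto_0] by blast
  then show ?thesis
    using ev_less_half[OF assms] by blast
qed

end
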